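(* Let $n$ be even and consider the complete graph $K_n$. Run asynchronous discordant voting starting from any initial colouring with exactly $n/2$ red and $n/2$ blue vertices, and let $T$ be the time to consensus. Then $\mathbf{E}\,T(\text{Push}) = \Theta(n\log n)$ and $\mathbf{E}\,T(\text{Pull}) = \Theta(2^n)$.
   Context: Discordant voting on a graph $G=(V,E)$: each vertex holds colour red or blue. An edge is discordant if its endpoints have different colours; a vertex is discordant if it is incident to a discordant edge; $D(X)$ is the set of discordant vertices of configuration $X$. Push rule: choose $v\in D(X_t)$ uniformly at random and a discordant neighbour $u$ of $v$ uniformly at random; $u$ adopts the colour of $v$. Pull rule: choose $v\in D(X_t)$ uniformly at random and a discordant neighbour $u$ of $v$ uniformly at random; $v$ adopts the colour of $u$. All other vertices keep their colours. $T$ is the first time at which all vertices have the same colour. *)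

theory Defs
  imports "HOL-Probability.Probability" "HOL-Library.Landau_Symbols"
begin

datatype colour = Red | Blue

text \<open>
  A graph is a vertex set \<open>V\<close> with a set \<open>E\<close> of two-element subsets of \<open>V\<close>. A configuration colours
  all elements of the type, but only the colours on \<open>V\<close> ever matter.
\<close>

type_synonym 'a config = "'a \<Rightarrow> colour"

definition complete_edges :: "'a set \<Rightarrow> 'a set set" where
  "complete_edges V = {e. e \<subseteq> V \<and> card e = 2}"

definition discordant_nbrs :: "'a set \<Rightarrow> 'a set set \<Rightarrow> 'a config \<Rightarrow> 'a \<Rightarrow> 'a set" where
  "discordant_nbrs V E X v = {u \<in> V. {u, v} \<in> E \<and> X u \<noteq> X v}"

definition discordant_vertices :: "'a set \<Rightarrow> 'a set set \<Rightarrow> 'a config \<Rightarrow> 'a set" where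
  "discordant_vertices V E X = {v \<in> V. discordant_nbrs V E X v \<noteq> {}}"

text \<open>
  If no vertex is discordant, the configuration is frozen; this also keeps \<^const>\<open>pmf_of_set\<close> away
  from the empty set, where it is unspecified. For the same reason \<open>V\<close> should be finite.
\<close>

definition push_step :: "'a set \<Rightarrow> 'a set set \<Rightarrow> 'a config \<Rightarrow> 'a config pmf" where
  "push_step V E X =
     (if discordant_vertices V E X = {} then return_pmf X
      else do {
        v \<leftarrow> pmf_of_set (discordant_vertices V E X);
        u \<leftarrow> pmf_of_set (discordant_nbrs V E X v);
        return_pmf (X(u := X v))
      })"

definition pull_step :: "'a set \<Rightarrow> 'a set set \<Rightarrow> 'a config \<Rightarrow> 'a config pmf" where
  "pull_step V E X =
     (if discordant_vertices V E X = {} then return_pmf X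
      else do {
        v \<leftarrow> pmf_of_set (discordant_vertices V E X);
        u \<leftarrow> pmf_of_set (discordant_nbrs V E X v);
        return_pmf (X(v := X u))
      })"

text \<open>
  The law, on the space of trajectories \<open>nat \<Rightarrow> 's\<close>, of the time-homogeneous Markov chain with
  transition kernel \<open>K\<close> started in \<open>x\<close>, obtained from the Ionescu-Tulcea theorem: given the
  history \<open>\<omega> 0, \<dots>, \<omega> t\<close>, the state at time \<open>t + 1\<close> is drawn from \<open>K (\<omega> t)\<close>.
\<close>

definition chain_kernel :: "('s \<Rightarrow> 's pmf) \<Rightarrow> 's \<Rightarrow> nat \<Rightarrow> (nat \<Rightarrow> 's) \<Rightarrow> 's measure" where
  "chain_kernel K x i \<omega> =
     (case i of 0 \<Rightarrow> measure_pmf (return_pmf x) | Suc t \<Rightarrow> measure_pmf (K (\<omega> t)))"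

definition chain_law :: "('s \<Rightarrow> 's pmf) \<Rightarrow> 's \<Rightarrow> (nat \<Rightarrow> 's) measure" where
  "chain_law K x =
     projective_family.lim UNIV
       (Ionescu_Tulcea.CI (chain_kernel K x) (\<lambda>_. count_space UNIV)) (\<lambda>_. count_space UNIV)"

text \<open>
  Outside their locales the constants above carry no guarantees, so we check that the locale
  assumptions are met and that \<^const>\<open>chain_law\<close> is a probability measure.
\<close>

lemma Ionescu_Tulcea_chain_kernel:
  fixes K :: "'s \<Rightarrow> 's pmf"
  shows "Ionescu_Tulcea (chain_kernel K x) (\<lambda>_. count_space UNIV)"
proof (rule Ionescu_Tulcea.intro)
  show "chain_kernel K x i \<in> measurable (PiM {0..<i} (\<lambda>_. count_space UNIV))
          (subprob_algebra (count_space UNIV))" for i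
  proof (cases i)
    case 0
    have "measure_pmf (return_pmf x) \<in> space (subprob_algebra (count_space UNIV))"
      by (rule measure_pmf_in_subprob_space)
    then show ?thesis
      by (simp add: 0 chain_kernel_def[abs_def])
  next
    case (Suc t)
    have "(\<lambda>\<omega>. \<omega> t) \<in> measurable (PiM {0..<Suc t} (\<lambda>_. count_space UNIV)) (count_space UNIV)"
      by (rule measurable_component_singleton) simp
    from measurable_compose[OF this, of "\<lambda>y. measure_pmf (K y)"]
    show ?thesis
      by (simp add: Suc chain_kernel_def[abs_def] measure_pmf_in_subprob_space)
  qed
next
  fix i and \<omega> :: "nat \<Rightarrow> 's"
  assume "\<omega> \<in> space (PiM {0..<i} (\<lambda>_. count_space UNIV))"
  show "prob_space (chain_kernel K x i \<omega>)"
    by (cases i) (simp_all add: chain_kernel_def measure_pmf.prob_space_axioms)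
qed

lemma sets_chain_law: "sets (chain_law K x) = sets (PiM UNIV (\<lambda>_. count_space UNIV))"
proof -
  interpret Ionescu_Tulcea "chain_kernel K x" "\<lambda>_. count_space UNIV"
    by (rule Ionescu_Tulcea_chain_kernel)
  show ?thesis
    by (simp add: chain_law_def)
qed

lemma prob_space_chain_law: "prob_space (chain_law K x)"
proof -
  interpret Ionescu_Tulcea "chain_kernel K x" "\<lambda>_. count_space UNIV"
    by (rule Ionescu_Tulcea_chain_kernel)
  have "prob_space (distr PF.lim (PiM {} (\<lambda>_. count_space UNIV)) (\<lambda>\<omega>. restrict \<omega> {}))"
    by (subst distr_lim) (auto intro: PF.prob_space_P)
  moreover have "(\<lambda>\<omega>. restrict \<omega> {}) \<in> measurable PF.lim (PiM {} (\<lambda>_. count_space UNIV))"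
    by (subst measurable_cong_sets[OF PF.sets_lim refl]) (rule measurable_restrict_subset, simp)
  ultimately show ?thesis
    unfolding chain_law_def by (rule prob_space_distrD[rotated])
qed

definition consensus :: "'a set \<Rightarrow> 'a config \<Rightarrow> bool" where
  "consensus V X \<longleftrightarrow> (\<forall>u\<in>V. \<forall>v\<in>V. X u = X v)"

text \<open>The value is \<open>\<infinity>\<close> (the infimum of the empty set) if consensus is never reached.\<close>

definition consensus_time :: "'a set \<Rightarrow> (nat \<Rightarrow> 'a config) \<Rightarrow> ennreal" where
  "consensus_time V \<omega> = (INF t\<in>{t. consensus V (\<omega> t)}. of_nat t)"

definition expected_consensus_time ::
    "'a set \<Rightarrow> ('a config \<Rightarrow> 'a config pmf) \<Rightarrow> 'a config \<Rightarrow> ennreal" where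
  "expected_consensus_time V K X = (\<integral>\<^sup>+ \<omega>. consensus_time V \<omega> \<partial>chain_law K X)"

definition ET_push :: "'a set \<Rightarrow> 'a set set \<Rightarrow> 'a config \<Rightarrow> ennreal" where
  "ET_push V E X = expected_consensus_time V (push_step V E) X"

definition ET_pull :: "'a set \<Rightarrow> 'a set set \<Rightarrow> 'a config \<Rightarrow> ennreal" where
  "ET_pull V E X = expected_consensus_time V (pull_step V E) X"

end

theory Submission
  imports Defs
begin

text \<open>
  A function that dominates one plus its own average under the kernel bounds the expected hitting
  time from above, and a bounded function that vanishes on the target and satisfies the reverse
  inequality bounds it from below. On the complete graph with \<open>2 m\<close> vertices the distance \<open>j\<close> of
  the number of red vertices from \<open>m\<close> is a birth-death chain, which moves outwards with probability
  \<open>(m + j) / 2 m\<close> (push) or \<open>(m - j) / 2 m\<close> (pull). For functions \<open>h j = d j + \<dots> + d (m - 1)\<close> of the distance the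
  two inequalities become a first-order recursion for \<open>d\<close>. The push recursion is bracketed by
  explicit increments of order \<open>m / j\<close> for \<open>j\<close> above the square root of \<open>m\<close>, whose sum is of order
  \<open>m ln m\<close>; the pull recursion is solved exactly after scaling by a binomial coefficient, and the
  last increment alone is of order \<open>2\<^sup>2\<^sup>m\<close>.
\<close>

section \<open>Hitting times of Markov chains\<close>

text \<open>The transition operator of the chain killed on \<open>A\<close>. Its \<open>t\<close>-th
  power takes expectations at time \<open>t\<close> over the paths that avoid \<open>A\<close>
  before time \<open>t\<close>.\<close>

definition killed :: "('s \<Rightarrow> bool) \<Rightarrow> ('s \<Rightarrow> 's pmf) \<Rightarrow> ('s \<Rightarrow> ennreal) \<Rightarrow> 's \<Rightarrow> ennreal" where
  "killed A K f y = (if A y then 0 else \<integral>\<^sup>+z. f z \<partial>K y)"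

text \<open>Only times strictly before \<open>t\<close> are tested, so that \<open>t = 0\<close>
  gives \<open>f\<close> at the start and each further time step costs exactly one application of
  \<open>killed\<close>.\<close>

definition before_hit :: "('s \<Rightarrow> bool) \<Rightarrow> nat \<Rightarrow> ('s \<Rightarrow> ennreal) \<Rightarrow> (nat \<Rightarrow> 's) \<Rightarrow> ennreal" where
  "before_hit A t f \<omega> = (if \<exists>s<t. A (\<omega> s) then 0 else f (\<omega> t))"

text \<open>The index set is left open because the functional is integrated both over finite
  histories and over full trajectories.\<close>

lemma measurable_before_hit:
  assumes "{..t} \<subseteq> J"
  shows "before_hit A t f \<in> borel_measurable (PiM J (\<lambda>_. count_space UNIV))"
proof -
  have "(\<lambda>\<omega>. A (\<omega> s)) \<in> measurable (PiM J (\<lambda>_. count_space UNIV)) (count_space UNIV)"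
    if "s \<le> t" for s
    by (rule measurable_compose[OF measurable_component_singleton]) (use that assms in auto)
  then have [measurable]: "Measurable.pred (PiM J (\<lambda>_. count_space UNIV)) (\<lambda>\<omega>. A (\<omega> s))"
    if "s < t" for s
    using that by simp
  have [measurable]: "(\<lambda>\<omega>. f (\<omega> t)) \<in> borel_measurable (PiM J (\<lambda>_. count_space UNIV))"
    by (rule measurable_compose[OF measurable_component_singleton]) (use assms in auto)
  have [measurable]: "Measurable.pred (PiM J (\<lambda>_. count_space UNIV)) (\<lambda>\<omega>. \<exists>s\<in>{..<t}. A (\<omega> s))"
    by (intro pred_intros_finite) auto
  have "(\<lambda>\<omega>. if \<exists>s\<in>{..<t}. A (\<omega> s) then 0 else f (\<omega> t)) \<in> borel_measurable (PiM J (\<lambda>_. count_space UNIV))"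
    by measurable
  then show ?thesis
    by (simp add: before_hit_def[abs_def] Bex_def)
qed

text \<open>This is the Markov property: integrating out the last coordinate of a finite history
  with the kernel replaces \<open>f\<close> at time \<open>t + 1\<close> by
  \<open>killed A K f\<close> at time \<open>t\<close>. Finite histories are marginals of the
  trajectory law, which transfers the identity.\<close>

lemma nn_integral_before_hit:
  "(\<integral>\<^sup>+\<omega>. before_hit A t f \<omega> \<partial>chain_law K x) = (killed A K ^^ t) f x"
proof -
  let ?S = "\<lambda>_::nat. count_space (UNIV :: 'a set)"
  \<comment> \<open>The only point of the product over the empty index set, that is, the empty
    history from which the construction starts.\<close>
  let ?u = "\<lambda>_::nat. undefined :: 'a"
  interpret Ionescu_Tulcea "chain_kernel K x" ?S
    by (rule Ionescu_Tulcea_chain_kernel)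
  have u: "?u \<in> space (PiM {0..<0} ?S)"
    by (simp add: space_PiM)
  have meas: "before_hit A s g \<in> borel_measurable (PiM {0..<Suc s} ?S)" for s g
    by (rule measurable_before_hit) auto
  have C: "(\<integral>\<^sup>+\<omega>. before_hit A t f \<omega> \<partial>C 0 (Suc t) ?u) = (killed A K ^^ t) f x"
  proof (induction t arbitrary: f)
    case 0
    have "C 0 (Suc 0) ?u = eP 0 ?u"
      using bind_return[OF measurable_eP u] by simp
    moreover have "(\<integral>\<^sup>+\<omega>. before_hit A 0 f \<omega> \<partial>eP 0 ?u) = f x"
      by (subst nn_integral_eP[OF u meas]) (simp add: chain_kernel_def before_hit_def)
    ultimately show ?case
      by simp
  next
    case (Suc t)
    have "(\<integral>\<^sup>+\<omega>. before_hit A (Suc t) f \<omega> \<partial>C 0 (Suc (Suc t)) ?u) =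
        (\<integral>\<^sup>+\<omega>. \<integral>\<^sup>+\<omega>'. before_hit A (Suc t) f \<omega>' \<partial>eP (Suc t) \<omega> \<partial>C 0 (Suc t) ?u)"
      unfolding C.simps(2)[of 0 "Suc t"] add_0
      using measurable_eP[of "Suc t"]
      by (intro nn_integral_bind[OF meas], subst measurable_cong_sets[OF sets_C[OF u, of "Suc t"] refl])
        (simp only: add_0)
    \<comment> \<open>Given the history, whether \<open>A\<close> was met by time \<open>t\<close>
      is already decided; only the value of \<open>f\<close> at the new coordinate is
      averaged.\<close>
    also have "\<dots> = (\<integral>\<^sup>+\<omega>. before_hit A t (killed A K f) \<omega> \<partial>C 0 (Suc t) ?u)"
    proof (rule nn_integral_cong)
      fix \<omega> assume "\<omega> \<in> space (C 0 (Suc t) ?u)"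
      then have \<omega>: "\<omega> \<in> space (PiM {0..<Suc t} ?S)"
        using space_C[OF u, of "Suc t"] by simp
      define hit where "hit \<longleftrightarrow> (\<exists>s<Suc t. A (\<omega> s))"
      have upd: "before_hit A (Suc t) f (fun_upd \<omega> (Suc t) y) = (if hit then 0 else f y)" for y
        by (auto simp: before_hit_def hit_def)
      have "before_hit A t (killed A K f) \<omega> = (if hit then 0 else \<integral>\<^sup>+y. f y \<partial>K (\<omega> t))"
        by (auto simp: before_hit_def hit_def killed_def less_Suc_eq)
      then show "(\<integral>\<^sup>+\<omega>'. before_hit A (Suc t) f \<omega>' \<partial>eP (Suc t) \<omega>) = before_hit A t (killed A K f) \<omega>"
        unfolding nn_integral_eP[OF \<omega> meas] upd by (simp add: chain_kernel_def)
    qed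
    also have "\<dots> = (killed A K ^^ Suc t) f x"
      by (subst Suc.IH) (simp add: funpow_swap1)
    finally show ?case .
  qed
  \<comment> \<open>\<open>CI J\<close> is the law of the first \<open>up_to J\<close> coordinates
    restricted to \<open>J\<close>, so for an initial segment it is the law \<open>C\<close> of the
    history.\<close>
  have up: "up_to {0..<Suc t} = Suc t"
    unfolding up_to_def by (rule Least_equality) (auto simp: not_less_eq_eq)
  have "C 0 (Suc t) ?u = distr (C 0 (Suc t) ?u) (PiM {0..<Suc t} ?S) (\<lambda>\<omega>. restrict \<omega> {0..<Suc t})"
    using distr_C[OF order_refl u, of "Suc t"] by simp
  also have "\<dots> = distr (chain_law K x) (PiM {0..<Suc t} ?S) (\<lambda>\<omega>. restrict \<omega> {0..<Suc t})"
    unfolding chain_law_def by (subst distr_lim) (simp_all add: CI_def up)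
  finally have eq: "C 0 (Suc t) ?u =
    distr (chain_law K x) (PiM {0..<Suc t} ?S) (\<lambda>\<omega>. restrict \<omega> {0..<Suc t})" .
  have "(\<integral>\<^sup>+\<omega>. before_hit A t f \<omega> \<partial>C 0 (Suc t) ?u) =
      (\<integral>\<^sup>+\<omega>. before_hit A t f (restrict \<omega> {0..<Suc t}) \<partial>chain_law K x)"
    unfolding eq
    by (rule nn_integral_distr, subst measurable_cong_sets[OF sets_chain_law refl],
        rule measurable_restrict_subset) (simp_all add: meas)
  also have "\<dots> = (\<integral>\<^sup>+\<omega>. before_hit A t f \<omega> \<partial>chain_law K x)"
    by (rule nn_integral_cong) (auto simp: before_hit_def)
  finally show ?thesis
    using C by simp
qed

section \<open>Expected hitting times as sums of survival probabilities\<close>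

definition hit_time :: "('s \<Rightarrow> bool) \<Rightarrow> (nat \<Rightarrow> 's) \<Rightarrow> ennreal" where
  "hit_time A \<omega> = (INF t\<in>{t. A (\<omega> t)}. of_nat t)"

abbreviation survival :: "('s \<Rightarrow> bool) \<Rightarrow> 's \<Rightarrow> ennreal" where
  "survival A \<equiv> \<lambda>y. if A y then 0 else 1"

text \<open>The \<open>t\<close>-th summand indicates that no hit occurs up to and including time
  \<open>t\<close>, and a value in the extended naturals is the number of naturals below it. If
  \<open>A\<close> is never met, both sides are infinite.\<close>

lemma hit_time_eq_suminf: "hit_time A \<omega> = (\<Sum>t. before_hit A t (survival A) \<omega>)"
proof (cases "\<exists>t. A (\<omega> t)")
  case True
  define n where "n = (LEAST t. A (\<omega> t))"
  have n: "A (\<omega> n)" "\<And>t. A (\<omega> t) \<Longrightarrow> n \<le> t"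
    using True by (auto simp: n_def intro: LeastI_ex Least_le)
  have "hit_time A \<omega> = of_nat n"
    unfolding hit_time_def by (rule antisym) (auto intro!: INF_lower INF_greatest n)
  also have "\<dots> = (\<Sum>t<n. before_hit A t (survival A) \<omega>)"
    using n(2) by (subst sum.cong[OF refl, of _ _ "\<lambda>_. 1"]) (force simp: before_hit_def)+
  also have "\<dots> = (\<Sum>t. before_hit A t (survival A) \<omega>)"
    by (rule suminf_finite[symmetric])
       (use n(1) in \<open>auto simp: before_hit_def not_less le_less\<close>)
  finally show ?thesis .
next
  case False
  then have "(\<Sum>t. before_hit A t (survival A) \<omega>) = (\<Sum>t. 1)"
    by (simp add: before_hit_def)
  also have "\<dots> = (SUP n. of_nat n)"
    by (subst suminf_eq_SUP) simp
  also have "\<dots> = \<infinity>"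
    by (simp add: ennreal_SUP_of_nat_eq_top)
  finally show ?thesis
    using False by (simp add: hit_time_def)
qed

lemma nn_integral_hit_time:
  "(\<integral>\<^sup>+\<omega>. hit_time A \<omega> \<partial>chain_law K x) = (\<Sum>t. (killed A K ^^ t) (survival A) x)"
  unfolding hit_time_eq_suminf nn_integral_before_hit[symmetric]
  by (rule nn_integral_suminf)
     (subst measurable_cong_sets[OF sets_chain_law refl], rule measurable_before_hit, simp)

lemma killed_add: "killed A K (\<lambda>y. f y + g y) y = killed A K f y + killed A K g y"
  by (simp add: killed_def nn_integral_add)

lemma killed_mono: "(\<And>y. f y \<le> g y) \<Longrightarrow> killed A K f y \<le> killed A K g y"
  by (auto simp: killed_def intro: nn_integral_mono)

lemma killed_sum: "killed A K (\<lambda>y. \<Sum>i<t. f i y) y = (\<Sum>i<t. killed A K (f i) y)" for t :: nat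
proof (induction t)
  case (Suc t)
  then show ?case by (simp add: killed_add)
qed (simp add: killed_def)

lemma killed_funpow_mono: "(\<And>y. f y \<le> g y) \<Longrightarrow> (killed A K ^^ t) f y \<le> (killed A K ^^ t) g y"
  by (induction t arbitrary: y) (auto intro: killed_mono)

lemma killed_cmult: "killed A K (\<lambda>y. c * f y) y = c * killed A K f y"
  by (simp add: killed_def nn_integral_cmult)

lemma killed_funpow_cmult: "(killed A K ^^ t) (\<lambda>y. c * f y) y = c * (killed A K ^^ t) f y"
proof (induction t arbitrary: y)
  case (Suc t)
  have "(killed A K ^^ t) (\<lambda>y. c * f y) = (\<lambda>y. c * (killed A K ^^ t) f y)"
    using Suc by auto
  then show ?case
    by (simp add: killed_cmult)
qed simp

text \<open>The partial sums of the survival probabilities obey the first-step recursion with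
  equality and start at 0, so by induction they stay below any supersolution
  \<open>h\<close>.\<close>

lemma expected_hit_time_le:
  fixes K :: "'s \<Rightarrow> 's pmf"
  assumes "\<And>y. \<not> A y \<Longrightarrow> 1 + (\<integral>\<^sup>+z. h z \<partial>K y) \<le> h y"
  shows "(\<integral>\<^sup>+\<omega>. hit_time A \<omega> \<partial>chain_law K x) \<le> h x"
proof -
  have step: "survival A y + killed A K h y \<le> h y" for y
    using assms by (auto simp: killed_def)
  have "(\<Sum>i<t. (killed A K ^^ i) (survival A) y) \<le> h y" for t y
  proof (induction t arbitrary: y)
    case (Suc t)
    have "(\<Sum>i<Suc t. (killed A K ^^ i) (survival A) y) =
        survival A y + killed A K (\<lambda>y. \<Sum>i<t. (killed A K ^^ i) (survival A) y) y"
      by (subst sum.lessThan_Suc_shift) (simp add: killed_sum)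
    also have "\<dots> \<le> survival A y + killed A K h y"
      by (intro add_left_mono killed_mono Suc)
    finally show ?case
      using step order_trans by blast
  qed simp
  then show ?thesis
    by (auto simp: nn_integral_hit_time suminf_eq_SUP intro: SUP_least)
qed

text \<open>Iterating the inequality \<open>t\<close> times leaves the remainder
  \<open>(killed A K ^^ t) g\<close>. It is at most \<open>c\<close> times the probability of
  survival, which tends to 0 because these probabilities are summable when the expectation is
  finite.\<close>

lemma expected_hit_time_ge:
  fixes K :: "'s \<Rightarrow> 's pmf"
  assumes sub: "\<And>y. \<not> A y \<Longrightarrow> g y \<le> 1 + (\<integral>\<^sup>+z. g z \<partial>K y)"
    and zero: "\<And>y. A y \<Longrightarrow> g y = 0"
    and bound: "\<And>y. g y \<le> c" and c: "c < \<infinity>"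
    and finite: "(\<integral>\<^sup>+\<omega>. hit_time A \<omega> \<partial>chain_law K x) < \<infinity>"
  shows "g x \<le> (\<integral>\<^sup>+\<omega>. hit_time A \<omega> \<partial>chain_law K x)"
proof -
  let ?q = "\<lambda>t. (killed A K ^^ t) (survival A)"
  have step: "g y \<le> survival A y + killed A K g y" for y
    using sub zero by (auto simp: killed_def)
  have le: "g y \<le> (\<Sum>i<t. ?q i y) + (killed A K ^^ t) g y" for t y
  proof (induction t arbitrary: y)
    case (Suc t)
    have "g y \<le> survival A y + killed A K g y"
      by (rule step)
    also have "\<dots> \<le> survival A y + killed A K (\<lambda>y. (\<Sum>i<t. ?q i y) + (killed A K ^^ t) g y) y"
      by (intro add_left_mono killed_mono Suc)
    also have "\<dots> = (\<Sum>i<Suc t. ?q i y) + (killed A K ^^ Suc t) g y"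
      by (subst sum.lessThan_Suc_shift) (simp add: killed_add killed_sum add.assoc)
    finally show ?case .
  qed simp
  \<comment> \<open>As \<open>g\<close> vanishes on \<open>A\<close> and is at most
    \<open>c\<close>, it lies below \<open>c\<close> times the survival indicator.\<close>
  have tail: "(killed A K ^^ t) g x \<le> c * ?q t x" for t
  proof -
    have "(killed A K ^^ t) g x \<le> (killed A K ^^ t) (\<lambda>y. c * survival A y) x"
      by (rule killed_funpow_mono) (use zero bound in auto)
    then show ?thesis
      by (simp only: killed_funpow_cmult)
  qed
  have fin: "(\<Sum>t. ?q t x) < \<infinity>"
    using finite by (simp only: nn_integral_hit_time)
  have "?q t x \<noteq> \<infinity>" for t
    using fin ennreal_suminf_lessD[of "\<lambda>t. ?q t x" "\<infinity>" t] by auto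
  then have r: "?q t x = ennreal (enn2real (?q t x))" for t
    by (simp add: top.not_eq_extremum)
  have "summable (\<lambda>t. enn2real (?q t x))"
    by (rule summable_suminf_not_top) (use fin r in auto)
  then have "(\<lambda>t. enn2real (?q t x)) \<longlonglongrightarrow> 0"
    by (rule summable_LIMSEQ_zero)
  then have "(\<lambda>t. ennreal (enn2real (?q t x))) \<longlonglongrightarrow> ennreal 0"
    by (rule tendsto_ennrealI)
  then have "(\<lambda>t. ?q t x) \<longlonglongrightarrow> 0"
    using r by simp
  then have "(\<lambda>t. c * ?q t x) \<longlonglongrightarrow> c * 0"
    by (intro ennreal_tendsto_cmult) (use c in auto)
  then have "(\<lambda>t. (\<Sum>t. ?q t x) + c * ?q t x) \<longlonglongrightarrow> (\<Sum>t. ?q t x) + 0"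
    by (intro tendsto_intros) auto
  moreover have "g x \<le> (\<Sum>t. ?q t x) + c * ?q t x" for t
    using le[of x t] tail[of t] sum_le_suminf[of "\<lambda>t. ?q t x" "{..<t}"]
    by (meson add_mono finite_lessThan order_trans summableI zero_le)
  ultimately have "g x \<le> (\<Sum>t. ?q t x) + 0"
    by (intro LIMSEQ_le_const) auto
  then show ?thesis
    by (simp add: nn_integral_hit_time)
qed

section \<open>Reduction to the imbalance of the colouring\<close>

lemma neq_Red_iff: "x \<noteq> Red \<longleftrightarrow> x = Blue"
  by (cases x) auto

definition reds :: "'a set \<Rightarrow> 'a config \<Rightarrow> nat" where
  "reds V X = card {v \<in> V. X v = Red}"

lemma card_blues:
  assumes "finite V"
  shows "card {v \<in> V. X v = Blue} = card V - reds V X"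
proof -
  have "{v \<in> V. X v = Blue} = V - {v \<in> V. X v = Red}"
    by (auto simp: neq_Red_iff[symmetric])
  then show ?thesis
    using assms by (simp add: reds_def card_Diff_subset)
qed

lemma reds_le: "finite V \<Longrightarrow> reds V X \<le> card V"
  unfolding reds_def by (rule card_mono) auto

lemma reds_upd_Red:
  assumes "finite V" "v \<in> V" "X v = Blue"
  shows "reds V (X(v := Red)) = Suc (reds V X)"
proof -
  have "{u \<in> V. (X(v := Red)) u = Red} = insert v {u \<in> V. X u = Red}"
    using assms by auto
  then show ?thesis
    using assms by (simp add: reds_def)
qed

lemma reds_upd_Blue:
  assumes "finite V" "v \<in> V" "X v = Red"
  shows "reds V (X(v := Blue)) = reds V X - 1"
proof -
  have "{u \<in> V. (X(v := Blue)) u = Red} = {u \<in> V. X u = Red} - {v}"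
    using assms by auto
  then show ?thesis
    using assms by (simp add: reds_def)
qed

lemma consensus_iff_reds:
  assumes "finite V"
  shows "consensus V X \<longleftrightarrow> reds V X = 0 \<or> reds V X = card V"
proof
  assume "reds V X = 0 \<or> reds V X = card V"
  then have "{v \<in> V. X v = Red} = {} \<or> {v \<in> V. X v = Red} = V"
    using assms card_subset_eq[OF assms, of "{v \<in> V. X v = Red}"] by (auto simp: reds_def)
  then show "consensus V X"
    unfolding consensus_def by (auto simp: set_eq_iff neq_Red_iff) metis
next
  assume c: "consensus V X"
  show "reds V X = 0 \<or> reds V X = card V"
  proof (cases "\<exists>v\<in>V. X v = Red")
    case True
    then have "X u = Red" if "u \<in> V" for u
      using c that unfolding consensus_def by metis
    then have "{v \<in> V. X v = Red} = V"
      by auto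
    then show ?thesis by (simp add: reds_def)
  next
    case False
    then have "{v \<in> V. X v = Red} = {}" by auto
    then show ?thesis by (simp only: reds_def card.empty simp_thms)
  qed
qed

lemma discordant_nbrs_complete:
  "v \<in> V \<Longrightarrow> discordant_nbrs V (complete_edges V) X v = {u \<in> V. X u \<noteq> X v}"
  by (auto simp: discordant_nbrs_def complete_edges_def card_2_iff)

text \<open>Without consensus both colours occur, and in a complete graph each vertex sees all
  vertices of the other colour. The first choice of either rule is thus uniform on
  \<open>V\<close>.\<close>

lemma discordant_vertices_complete:
  assumes "finite V" "\<not> consensus V X"
  shows "discordant_vertices V (complete_edges V) X = V"
    and "\<And>v. v \<in> V \<Longrightarrow> {u \<in> V. X u \<noteq> X v} \<noteq> {}"
proof -
  show *: "{u \<in> V. X u \<noteq> X v} \<noteq> {}" if "v \<in> V" for v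
    using assms that unfolding consensus_def by (metis (mono_tags, lifting) empty_Collect_eq)
  show "discordant_vertices V (complete_edges V) X = V"
  proof -
    have "discordant_nbrs V (complete_edges V) X v \<noteq> {}" if "v \<in> V" for v
      unfolding discordant_nbrs_complete[OF that] by (rule *[OF that])
    then show ?thesis
      unfolding discordant_vertices_def by blast
  qed
qed

section \<open>One step of each rule, seen through the number of red vertices\<close>

lemma sum_over_colours:
  fixes a b :: ennreal
  assumes "finite V"
  shows "(\<Sum>v\<in>V. if X v = Red then a else b) = of_nat (reds V X) * a + of_nat (card V - reds V X) * b"
proof -
  have "{v \<in> V. X v \<noteq> Red} = {v \<in> V. X v = Blue}"
    by (auto simp: neq_Red_iff[symmetric])
  then show ?thesis
    using assms card_blues[OF assms, of X]
    by (simp add: sum.If_cases reds_def Int_def)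
qed

text \<open>The colour of the uniform vertex \<open>v\<close> gains one vertex whichever discordant
  neighbour is picked, so the red count rises exactly when \<open>v\<close> is red.\<close>

lemma nn_integral_push_step:
  assumes fin: "finite V" and nc: "\<not> consensus V X"
  shows "(\<integral>\<^sup>+Y. F (reds V Y) \<partial>push_step V (complete_edges V) X) =
    (of_nat (reds V X) * F (Suc (reds V X)) + of_nat (card V - reds V X) * F (reds V X - 1)) /
      of_nat (card V)"
proof -
  note D = discordant_vertices_complete[OF fin nc]
  have ne: "V \<noteq> {}"
    using nc by (auto simp: consensus_def)
  have "(\<integral>\<^sup>+Y. F (reds V Y) \<partial>push_step V (complete_edges V) X) =
      (\<Sum>v\<in>V. \<integral>\<^sup>+u. F (reds V (X(u := X v)))
         \<partial>pmf_of_set (discordant_nbrs V (complete_edges V) X v)) / of_nat (card V)"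
    using ne fin by (simp add: push_step_def D nn_integral_pmf_of_set)
  also have "(\<Sum>v\<in>V. \<integral>\<^sup>+u. F (reds V (X(u := X v)))
         \<partial>pmf_of_set (discordant_nbrs V (complete_edges V) X v)) =
      (\<Sum>v\<in>V. if X v = Red then F (Suc (reds V X)) else F (reds V X - 1))"
  proof (rule sum.cong[OF refl])
    fix v assume v: "v \<in> V"
    have "(\<integral>\<^sup>+u. F (reds V (X(u := X v))) \<partial>pmf_of_set {u \<in> V. X u \<noteq> X v}) =
        (\<integral>\<^sup>+u. (if X v = Red then F (Suc (reds V X)) else F (reds V X - 1))
          \<partial>pmf_of_set {u \<in> V. X u \<noteq> X v})"
    proof (rule nn_integral_cong_AE, rule AE_pmfI)
      fix u assume "u \<in> set_pmf (pmf_of_set {u \<in> V. X u \<noteq> X v})"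
      then have "u \<in> V" "X u \<noteq> X v"
        using D(2)[OF v] fin by auto
      then show "F (reds V (X(u := X v))) =
          (if X v = Red then F (Suc (reds V X)) else F (reds V X - 1))"
        using fin reds_upd_Red[of V u X] reds_upd_Blue[of V u X]
        by (cases "X v"; cases "X u") auto
    qed
    then show "(\<integral>\<^sup>+u. F (reds V (X(u := X v)))
          \<partial>pmf_of_set (discordant_nbrs V (complete_edges V) X v)) =
        (if X v = Red then F (Suc (reds V X)) else F (reds V X - 1))"
      using v by (simp add: discordant_nbrs_complete measure_pmf.emeasure_space_1)
  qed
  finally show ?thesis
    using fin by (simp add: sum_over_colours)
qed

text \<open>Here \<open>v\<close> itself switches colour, so the red count falls exactly when
  \<open>v\<close> is red: the weights of the push rule are swapped.\<close>

lemma nn_integral_pull_step: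
  assumes fin: "finite V" and nc: "\<not> consensus V X"
  shows "(\<integral>\<^sup>+Y. F (reds V Y) \<partial>pull_step V (complete_edges V) X) =
    (of_nat (reds V X) * F (reds V X - 1) + of_nat (card V - reds V X) * F (Suc (reds V X))) /
      of_nat (card V)"
proof -
  note D = discordant_vertices_complete[OF fin nc]
  have ne: "V \<noteq> {}"
    using nc by (auto simp: consensus_def)
  have "(\<integral>\<^sup>+Y. F (reds V Y) \<partial>pull_step V (complete_edges V) X) =
      (\<Sum>v\<in>V. \<integral>\<^sup>+u. F (reds V (X(v := X u)))
         \<partial>pmf_of_set (discordant_nbrs V (complete_edges V) X v)) / of_nat (card V)"
    using ne fin by (simp add: pull_step_def D nn_integral_pmf_of_set)
  also have "(\<Sum>v\<in>V. \<integral>\<^sup>+u. F (reds V (X(v := X u)))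
         \<partial>pmf_of_set (discordant_nbrs V (complete_edges V) X v)) =
      (\<Sum>v\<in>V. if X v = Red then F (reds V X - 1) else F (Suc (reds V X)))"
  proof (rule sum.cong[OF refl])
    fix v assume v: "v \<in> V"
    have "(\<integral>\<^sup>+u. F (reds V (X(v := X u))) \<partial>pmf_of_set {u \<in> V. X u \<noteq> X v}) =
        (\<integral>\<^sup>+u. (if X v = Red then F (reds V X - 1) else F (Suc (reds V X)))
          \<partial>pmf_of_set {u \<in> V. X u \<noteq> X v})"
    proof (rule nn_integral_cong_AE, rule AE_pmfI)
      fix u assume "u \<in> set_pmf (pmf_of_set {u \<in> V. X u \<noteq> X v})"
      then have "X u \<noteq> X v"
        using D(2)[OF v] fin by auto
      then show "F (reds V (X(v := X u))) =
          (if X v = Red then F (reds V X - 1) else F (Suc (reds V X)))"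
        using fin v reds_upd_Red[of V v X] reds_upd_Blue[of V v X]
        by (cases "X v"; cases "X u") auto
    qed
    then show "(\<integral>\<^sup>+u. F (reds V (X(v := X u)))
          \<partial>pmf_of_set (discordant_nbrs V (complete_edges V) X v)) =
        (if X v = Red then F (reds V X - 1) else F (Suc (reds V X)))"
      using v by (simp add: discordant_nbrs_complete measure_pmf.emeasure_space_1)
  qed
  finally show ?thesis
    using fin by (simp add: sum_over_colours)
qed

text \<open>Subtraction truncates, so this is the distance of the number of red vertices from \<open>m\<close>.\<close>

definition imbalance :: "'a set \<Rightarrow> nat \<Rightarrow> 'a config \<Rightarrow> nat" where
  "imbalance V m X = (reds V X - m) + (m - reds V X)"

text \<open>\<open>c j / (2 m)\<close> is the probability of a step away from balance at imbalance \<open>0 < j < m\<close>.\<close>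

locale imbalance_walk =
  fixes V :: "'a set" and m :: nat and K :: "'a config \<Rightarrow> 'a config pmf" and c :: "nat \<Rightarrow> real"
  assumes fin: "finite V" and card_V: "card V = 2 * m"
    and c_bounds: "\<And>j. j < m \<Longrightarrow> 0 \<le> c j" "\<And>j. j < m \<Longrightarrow> c j \<le> 2 * real m"
    and transition: "\<And>X F. \<not> consensus V X \<Longrightarrow> (\<And>j. 0 \<le> F j) \<Longrightarrow>
      (\<integral>\<^sup>+Y. ennreal (F (imbalance V m Y)) \<partial>K X) =
        ennreal (if imbalance V m X = 0 then F 1 else
          (c (imbalance V m X) * F (Suc (imbalance V m X)) +
           (2 * real m - c (imbalance V m X)) * F (imbalance V m X - 1)) / (2 * real m))"
begin

lemma consensus_iff: "consensus V X \<longleftrightarrow> imbalance V m X = m"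
  using consensus_iff_reds[OF fin, of X] reds_le[OF fin, of X]
  by (auto simp: imbalance_def card_V)

lemma imbalance_less: "\<not> consensus V X \<Longrightarrow> imbalance V m X < m"
  using consensus_iff_reds[OF fin, of X] reds_le[OF fin, of X]
  by (auto simp: imbalance_def card_V)

text \<open>For the tail sums \<open>H\<close> of \<open>d\<close>, the condition of
  \<open>expected_hit_time_le\<close> involves only the differences
  \<open>H j - H (Suc j) = d j\<close> and \<open>H (j - 1) - H j = d (j - 1)\<close>; multiplied by
  \<open>2 * m\<close> it is \<open>super\<close>. At balance the walk always moves to imbalance 1,
  which gives \<open>1 \<le> d 0\<close>. The guard \<open>0 < m\<close> there accommodates
  \<open>push_super 0 0 = 0\<close>.\<close>

lemma expected_consensus_time_le:
  assumes d: "\<And>j. j < m \<Longrightarrow> 0 \<le> d j" "0 < m \<Longrightarrow> 1 \<le> d 0"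
    and super: "\<And>j. 0 < j \<Longrightarrow> j < m \<Longrightarrow> 2 * real m + (2 * real m - c j) * d (j - 1) \<le> c j * d j"
  shows "expected_consensus_time V K X \<le> ennreal (\<Sum>j\<in>{imbalance V m X..<m}. d j)"
proof -
  define H where "H j = (\<Sum>i\<in>{j..<m}. d i)" for j
  have H0: "0 \<le> H j" for j
    unfolding H_def by (rule sum_nonneg) (use d in auto)
  have HS: "H j = d j + H (Suc j)" if "j < m" for j
    using that unfolding H_def by (simp add: sum.atLeast_Suc_lessThan)
  have "(\<integral>\<^sup>+\<omega>. hit_time (consensus V) \<omega> \<partial>chain_law K X) \<le> ennreal (H (imbalance V m X))"
  proof (rule expected_hit_time_le)
    fix Y assume nc: "\<not> consensus V Y"
    define j where "j = imbalance V m Y"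
    have jm: "j < m"
      using imbalance_less[OF nc] by (simp add: j_def)
    define w where "w = (if j = 0 then H 1 else
      (c j * H (Suc j) + (2 * real m - c j) * H (j - 1)) / (2 * real m))"
    have tr: "(\<integral>\<^sup>+z. ennreal (H (imbalance V m z)) \<partial>K Y) = ennreal w"
      unfolding w_def j_def by (rule transition[OF nc, where F = H, OF H0])
    have w0: "0 \<le> w"
      unfolding w_def using H0 c_bounds[OF jm] by auto
    have "1 + w \<le> H j"
    proof (cases "j = 0")
      case True
      then show ?thesis
        using HS[of 0] d(2) jm by (simp add: w_def)
    next
      case False
      then have "2 * real m + (c j * H (Suc j) + (2 * real m - c j) * H (j - 1)) \<le> 2 * real m * H j"
        using super[of j] jm HS[of j] HS[of "j - 1"] by (simp add: algebra_simps)
      then have "1 + w \<le> 2 * real m * H j / (2 * real m)"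
        using False jm by (simp add: w_def field_simps)
      then show ?thesis
        using jm by simp
    qed
    then have "ennreal (1 + w) \<le> ennreal (H (imbalance V m Y))"
      unfolding j_def by (rule ennreal_leI)
    then have "1 + ennreal w \<le> ennreal (H (imbalance V m Y))"
      using w0 by (simp add: ennreal_plus)
    then show "1 + (\<integral>\<^sup>+z. ennreal (H (imbalance V m z)) \<partial>K Y) \<le> ennreal (H (imbalance V m Y))"
      unfolding tr .
  qed
  then show ?thesis
    by (simp add: expected_consensus_time_def consensus_time_def hit_time_def H_def)
qed

text \<open>The same translation with reversed inequalities. \<open>H\<close> is an empty sum at
  consensus and never exceeds \<open>H 0\<close>, as \<open>expected_hit_time_ge\<close>
  demands.\<close>

lemma expected_consensus_time_ge:
  assumes d: "\<And>j. j < m \<Longrightarrow> 0 \<le> d j" "d 0 \<le> 1"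
    and sub: "\<And>j. 0 < j \<Longrightarrow> j < m \<Longrightarrow> c j * d j \<le> 2 * real m + (2 * real m - c j) * d (j - 1)"
    and finite: "expected_consensus_time V K X < \<infinity>"
  shows "ennreal (\<Sum>j\<in>{imbalance V m X..<m}. d j) \<le> expected_consensus_time V K X"
proof -
  define H where "H j = (\<Sum>i\<in>{j..<m}. d i)" for j
  have H0: "0 \<le> H j" for j
    unfolding H_def by (rule sum_nonneg) (use d in auto)
  have HS: "H j = d j + H (Suc j)" if "j < m" for j
    using that unfolding H_def by (simp add: sum.atLeast_Suc_lessThan)
  have eq: "expected_consensus_time V K X = (\<integral>\<^sup>+\<omega>. hit_time (consensus V) \<omega> \<partial>chain_law K X)"
    by (simp add: expected_consensus_time_def consensus_time_def hit_time_def)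
  have "ennreal (H (imbalance V m X)) \<le> (\<integral>\<^sup>+\<omega>. hit_time (consensus V) \<omega> \<partial>chain_law K X)"
  proof (rule expected_hit_time_ge)
    fix Y assume nc: "\<not> consensus V Y"
    define j where "j = imbalance V m Y"
    have jm: "j < m"
      using imbalance_less[OF nc] by (simp add: j_def)
    define w where "w = (if j = 0 then H 1 else
      (c j * H (Suc j) + (2 * real m - c j) * H (j - 1)) / (2 * real m))"
    have tr: "(\<integral>\<^sup>+z. ennreal (H (imbalance V m z)) \<partial>K Y) = ennreal w"
      unfolding w_def j_def by (rule transition[OF nc, where F = H, OF H0])
    have w0: "0 \<le> w"
      unfolding w_def using H0 c_bounds[OF jm] by auto
    have "H j \<le> 1 + w"
    proof (cases "j = 0")
      case True
      then show ?thesis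
        using HS[of 0] d(2) jm by (simp add: w_def)
    next
      case False
      then have "2 * real m * H j \<le> 2 * real m + (c j * H (Suc j) + (2 * real m - c j) * H (j - 1))"
        using sub[of j] jm HS[of j] HS[of "j - 1"] by (simp add: algebra_simps)
      then have "2 * real m * H j / (2 * real m) \<le> 1 + w"
        using False jm by (simp add: w_def field_simps)
      then show ?thesis
        using jm by simp
    qed
    then have "ennreal (H (imbalance V m Y)) \<le> ennreal (1 + w)"
      unfolding j_def by (rule ennreal_leI)
    then have "ennreal (H (imbalance V m Y)) \<le> 1 + ennreal w"
      using w0 by (simp add: ennreal_plus)
    then show "ennreal (H (imbalance V m Y)) \<le> 1 + (\<integral>\<^sup>+z. ennreal (H (imbalance V m z)) \<partial>K Y)"
      unfolding tr .
  next
    fix Y assume "consensus V Y"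
    then show "ennreal (H (imbalance V m Y)) = 0"
      by (simp add: consensus_iff H_def)
  next
    fix Y
    show "ennreal (H (imbalance V m Y)) \<le> ennreal (H 0)"
      unfolding H_def by (intro ennreal_leI sum_mono2) (use d in auto)
  next
    show "(\<integral>\<^sup>+\<omega>. hit_time (consensus V) \<omega> \<partial>chain_law K X) < \<infinity>"
      using finite eq by simp
  qed auto
  then show ?thesis
    by (simp add: eq H_def)
qed

end

lemma ennreal_weighted_average:
  assumes "0 \<le> x" "0 \<le> y" "0 < n"
  shows "(of_nat a * ennreal x + of_nat b * ennreal y) / of_nat n = ennreal ((real a * x + real b * y) / real n)"
  using assms
  by (simp add: ennreal_of_nat_eq_real_of_nat ennreal_mult[symmetric] ennreal_plus[symmetric]
      divide_ennreal del: ennreal_plus)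

text \<open>A step leads away from balance exactly when \<open>v\<close> has the majority colour,
  which \<open>m + j\<close> vertices have. From balance both moves lead to imbalance 1.\<close>

lemma imbalance_walk_push:
  assumes fin: "finite V" and card: "card V = 2 * m"
  shows "imbalance_walk V m (push_step V (complete_edges V)) (\<lambda>j. real (m + j))"
proof
  fix X :: "'a config" and F :: "nat \<Rightarrow> real"
  assume nc: "\<not> consensus V X" and F: "\<And>j. 0 \<le> F j"
  let ?r = "reds V X"
  \<comment> \<open>Both colours are present, so the truncated subtractions \<open>?r - 1\<close>
    and \<open>2 * m - ?r\<close> are genuine.\<close>
  have r: "0 < ?r" "?r < 2 * m"
    using nc consensus_iff_reds[OF fin, of X] reds_le[OF fin, of X] card by auto
  define F' where "F' k = F ((k - m) + (m - k))" for k
  have "(\<integral>\<^sup>+Y. ennreal (F (imbalance V m Y)) \<partial>push_step V (complete_edges V) X) =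
      (of_nat ?r * ennreal (F' (Suc ?r)) + of_nat (2 * m - ?r) * ennreal (F' (?r - 1))) / of_nat (2 * m)"
    using nn_integral_push_step[OF fin nc, of "\<lambda>k. ennreal (F' k)"] card
    by (simp add: F'_def imbalance_def)
  also have "\<dots> = ennreal ((real ?r * F' (Suc ?r) + (2 * real m - real ?r) * F' (?r - 1)) / (2 * real m))"
    using ennreal_weighted_average[of "F' (Suc ?r)" "F' (?r - 1)" "2 * m" ?r "2 * m - ?r"] F r
    by (simp add: F'_def of_nat_diff)
  also have "(real ?r * F' (Suc ?r) + (2 * real m - real ?r) * F' (?r - 1)) / (2 * real m) =
      (if imbalance V m X = 0 then F 1 else
          (real (m + imbalance V m X) * F (Suc (imbalance V m X)) +
           (2 * real m - real (m + imbalance V m X)) * F (imbalance V m X - 1)) / (2 * real m))"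
  proof -
    consider "?r = m" | "?r < m" | "m < ?r" by linarith
    then show ?thesis
    proof cases
      case 1
      then show ?thesis
        using r by (simp add: F'_def imbalance_def field_simps)
    next
      case 2
      then have "F' (Suc ?r) = F (m - ?r - 1)" "F' (?r - 1) = F (Suc (m - ?r))"
        using r by (simp_all add: F'_def Suc_diff_le)
      then show ?thesis
        using 2 r by (simp add: imbalance_def of_nat_diff add.commute)
    next
      case 3
      then have "F' (Suc ?r) = F (Suc (?r - m))" "F' (?r - 1) = F (?r - m - 1)"
        using r by (simp_all add: F'_def Suc_diff_le)
      then show ?thesis
        using 3 r by (simp add: imbalance_def of_nat_diff)
    qed
  qed
  finally show "(\<integral>\<^sup>+Y. ennreal (F (imbalance V m Y)) \<partial>push_step V (complete_edges V) X) = \<dots>" .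
qed (use fin card in auto)

text \<open>A step leads away from balance exactly when \<open>v\<close> has the minority colour,
  which \<open>m - j\<close> vertices have.\<close>

lemma imbalance_walk_pull:
  assumes fin: "finite V" and card: "card V = 2 * m"
  shows "imbalance_walk V m (pull_step V (complete_edges V)) (\<lambda>j. real m - real j)"
proof
  fix X :: "'a config" and F :: "nat \<Rightarrow> real"
  assume nc: "\<not> consensus V X" and F: "\<And>j. 0 \<le> F j"
  let ?r = "reds V X"
  have r: "0 < ?r" "?r < 2 * m"
    using nc consensus_iff_reds[OF fin, of X] reds_le[OF fin, of X] card by auto
  define F' where "F' k = F ((k - m) + (m - k))" for k
  have "(\<integral>\<^sup>+Y. ennreal (F (imbalance V m Y)) \<partial>pull_step V (complete_edges V) X) =
      (of_nat ?r * ennreal (F' (?r - 1)) + of_nat (2 * m - ?r) * ennreal (F' (Suc ?r))) / of_nat (2 * m)"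
    using nn_integral_pull_step[OF fin nc, of "\<lambda>k. ennreal (F' k)"] card
    by (simp add: F'_def imbalance_def)
  also have "\<dots> = ennreal ((real ?r * F' (?r - 1) + (2 * real m - real ?r) * F' (Suc ?r)) / (2 * real m))"
    using ennreal_weighted_average[of "F' (?r - 1)" "F' (Suc ?r)" "2 * m" ?r "2 * m - ?r"] F r
    by (simp add: F'_def of_nat_diff)
  also have "(real ?r * F' (?r - 1) + (2 * real m - real ?r) * F' (Suc ?r)) / (2 * real m) =
      (if imbalance V m X = 0 then F 1 else
          ((real m - real (imbalance V m X)) * F (Suc (imbalance V m X)) +
           (2 * real m - (real m - real (imbalance V m X))) * F (imbalance V m X - 1)) / (2 * real m))"
  proof -
    consider "?r = m" | "?r < m" | "m < ?r" by linarith
    then show ?thesis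
    proof cases
      case 1
      then show ?thesis
        using r by (simp add: F'_def imbalance_def field_simps)
    next
      case 2
      then have "F' (Suc ?r) = F (m - ?r - 1)" "F' (?r - 1) = F (Suc (m - ?r))"
        using r by (simp_all add: F'_def Suc_diff_le)
      then show ?thesis
        using 2 r by (simp add: imbalance_def of_nat_diff)
    next
      case 3
      then have "F' (Suc ?r) = F (Suc (?r - m))" "F' (?r - 1) = F (?r - m - 1)"
        using r by (simp_all add: F'_def Suc_diff_le)
      then show ?thesis
        using 3 r by (simp add: imbalance_def of_nat_diff add.commute)
    qed
  qed
  finally show "(\<integral>\<^sup>+Y. ennreal (F (imbalance V m Y)) \<partial>pull_step V (complete_edges V) X) = \<dots>" .
qed (use fin card in auto)

section \<open>Increments of the hitting-time functions\<close>

text \<open>\<open>2 * j + 1\<close> solves the driftless recursion (\<open>c j\<close> replaced by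
  \<open>m\<close>) from 1, while \<open>m / j\<close> balances the recursion with drift when
  \<open>d\<close> is treated as locally constant. The two branches cross near the square root of
  \<open>2 * m\<close>; the factor 4 gives slack.\<close>

definition push_super :: "nat \<Rightarrow> nat \<Rightarrow> real" where
  "push_super m j = min (2 * real j + 1) (4 * real m / (real j + 1))"

text \<open>The minimum at \<open>j - 1\<close> is below both of its branches, so it may be
  estimated by whichever branch is attained at \<open>j\<close>.\<close>

lemma push_super_step:
  assumes "0 < j" "j < m"
  shows "2 * real m + (2 * real m - real (m + j)) * push_super m (j - 1) \<le> real (m + j) * push_super m j"
proof -
  define M x where "M = real m" and "x = real j"
  have x: "1 \<le> x" "x < M" and j1: "real (j - Suc 0) = x - 1"
    using assms by (auto simp: M_def x_def)
  have "push_super m (j - 1) \<le> 2 * x - 1" "push_super m (j - 1) \<le> 4 * M / x"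
    by (simp_all add: push_super_def j1 M_def[symmetric])
  then have prev: "(M - x) * push_super m (j - 1) \<le> (M - x) * (2 * x - 1)"
      "(M - x) * push_super m (j - 1) \<le> (M - x) * (4 * M / x)"
    using x by (intro mult_left_mono; simp)+
  have "2 * M + (M - x) * push_super m (j - 1) \<le> (M + x) * push_super m j"
  proof (cases "2 * x + 1 \<le> 4 * M / (x + 1)")
    case True
    then have eq: "push_super m j = 2 * x + 1"
      by (simp add: push_super_def M_def x_def)
    have "2 * M + (M - x) * (2 * x - 1) \<le> (M + x) * (2 * x + 1)"
      using x by (simp add: algebra_simps)
    then show ?thesis
      unfolding eq using prev(1) by linarith
  next
    case False
    then have eq: "push_super m j = 4 * M / (x + 1)"
      by (simp add: push_super_def M_def x_def)
    have "4 * M \<le> (2 * x + 1) * (x + 1)"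
      using False x by (simp add: field_simps)
    moreover have "1 \<le> x * x"
      using x mult_mono[of 1 x 1 x] by simp
    \<comment> \<open>The target inequality after clearing the denominators \<open>x\<close> and
      \<open>x + 1\<close> and cancelling \<open>2 * M\<close>. It holds because
      \<open>2 * x + 1\<close> is the larger branch, which forces \<open>x\<close> to be at least of
      order the square root of \<open>M\<close>.\<close>
    ultimately have "x * (x + 1) \<le> 2 * (2 * x * x + x - M)"
      using x by (simp add: algebra_simps)
    then have "2 * M * (x * (x + 1)) \<le> 2 * M * (2 * (2 * x * x + x - M))"
      using x by (intro mult_left_mono) auto
    then have "2 * M + (M - x) * (4 * M / x) \<le> (M + x) * (4 * M / (x + 1))"
      using x by (simp add: field_simps)
    then show ?thesis
      unfolding eq using prev(2) by linarith
  qed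
  then show ?thesis
    by (simp add: M_def x_def)
qed

lemma sum_push_super_le:
  assumes "0 < m"
  shows "(\<Sum>j\<in>{0..<m}. push_super m j) \<le> 4 * real m * (1 + ln (real m))"
proof -
  \<comment> \<open>The harmonic number minus the logarithm decreases from its value 1 at the first
    index.\<close>
  have harm: "harm m \<le> 1 + ln (real m)"
    using decseqD[OF decseq_harm_diff_ln, of 0 "m - 1"] assms by (simp add: harm_def)
  have "(\<Sum>j\<in>{0..<m}. push_super m j) \<le> (\<Sum>j\<in>{0..<m}. 4 * real m * (1 / real (Suc j)))"
    by (rule sum_mono) (simp add: push_super_def add.commute)
  also have "\<dots> = 4 * real m * harm m"
    unfolding sum_distrib_left[symmetric]
    by (simp add: harm_def atLeast0LessThan sum.atLeast1_atMost_eq inverse_eq_divide)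
  also have "\<dots> \<le> 4 * real m * (1 + ln (real m))"
    using harm by (intro mult_left_mono) auto
  finally show ?thesis .
qed

text \<open>One smooth formula for both regimes: about \<open>j / 2\<close> below the square root of
  \<open>m\<close> and about \<open>m / (2 * j)\<close> above it.\<close>

definition push_sub :: "nat \<Rightarrow> nat \<Rightarrow> real" where
  "push_sub m j = real m / 2 * (real j / (real m + (real j)\<^sup>2))"

text \<open>With the factor \<open>M / 2\<close> removed, the claim is that
  \<open>M * (f x - f (x - 1)) + x * f x + x * f (x - 1)\<close> is at most 4; the three terms are
  bounded by 1, 1 and 2.\<close>

lemma push_sub_step:
  assumes "0 < j" "j < m"
  shows "real (m + j) * push_sub m j \<le> 2 * real m + (2 * real m - real (m + j)) * push_sub m (j - 1)"
proof -
  define M x where "M = real m" and "x = real j"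
  have x: "1 \<le> x" "x < M" and j1: "real (j - Suc 0) = x - 1"
    using assms by (auto simp: M_def x_def)
  define f where "f y = y / (M + y\<^sup>2)" for y :: real
  have pos: "0 < M + y\<^sup>2" for y
    using x by (simp add: add_pos_nonneg)
  have xf: "x * f x \<le> 1"
    using x pos[of x] by (simp add: f_def field_simps power2_eq_square)
  have xf1: "x * f (x - 1) \<le> 2"
  proof -
    have "x * (x - 1) \<le> 2 * (M + (x - 1)\<^sup>2)"
    proof -
      have "0 \<le> (x - 2)\<^sup>2" by simp
      then show ?thesis using x by (simp add: power2_eq_square algebra_simps)
    qed
    then show ?thesis
      using pos[of "x - 1"] by (simp add: f_def field_simps)
  qed
  have diff: "M * (f x - f (x - 1)) \<le> 1"
  proof -
    have "f x \<le> x / (M + (x - 1)\<^sup>2)"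
      unfolding f_def using x pos by (intro divide_left_mono) (auto intro: power_mono)
    then have "f x - f (x - 1) \<le> 1 / (M + (x - 1)\<^sup>2)"
      by (simp add: f_def diff_divide_distrib)
    then have "M * (f x - f (x - 1)) \<le> M * (1 / (M + (x - 1)\<^sup>2))"
      using x by (intro mult_left_mono) auto
    also have "\<dots> \<le> 1"
      using x pos[of "x - 1"] by simp
    finally show ?thesis .
  qed
  have "(M + x) * f x - (M - x) * f (x - 1) \<le> 4"
    using xf xf1 diff by (simp add: algebra_simps)
  then have "M / 2 * ((M + x) * f x - (M - x) * f (x - 1)) \<le> M / 2 * 4"
    using x by (intro mult_left_mono) auto
  moreover have "M / 2 * ((M + x) * f x - (M - x) * f (x - 1)) =
      (M + x) * (M / 2 * f x) - (2 * M - (M + x)) * (M / 2 * f (x - 1))"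
    by (simp add: field_simps)
  ultimately have "(M + x) * (M / 2 * f x) \<le> 2 * M + (2 * M - (M + x)) * (M / 2 * f (x - 1))"
    by linarith
  then show ?thesis
    by (simp add: push_sub_def f_def M_def x_def j1[unfolded x_def])
qed

text \<open>\<open>j / (m + j\<^sup>2)\<close> is, up to a factor, the derivative of
  \<open>ln (m + j\<^sup>2)\<close>, so the sum is compared with a telescoping one. The loss of 3
  comes from \<open>2 * j + 1 \<le> 3 * j\<close>, hence the start at \<open>j = 1\<close>.\<close>

lemma sum_push_sub_ge:
  assumes "0 < m"
  shows "real m / 6 * ln (real m) \<le> (\<Sum>j\<in>{0..<m}. push_sub m j)"
proof -
  define L where "L j = ln (real m + (real j)\<^sup>2)" for j
  have pos: "0 < real m + (real j)\<^sup>2" for j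
    using assms by (simp add: add_pos_nonneg)
  have step: "L (Suc j) - L j \<le> 3 * (real j / (real m + (real j)\<^sup>2))" if "1 \<le> j" for j
  proof -
    have "L (Suc j) - L j \<le> ((real m + (real (Suc j))\<^sup>2) - (real m + (real j)\<^sup>2)) / (real m + (real j)\<^sup>2)"
      unfolding L_def by (rule ln_diff_le[OF pos pos])
    also have "\<dots> \<le> (3 * real j) / (real m + (real j)\<^sup>2)"
      using that pos[of j] by (intro divide_right_mono) (auto simp: power2_eq_square algebra_simps)
    finally show ?thesis by simp
  qed
  have "ln (real m) = L m - L 1"
  proof -
    have "real m + (real m)\<^sup>2 = real m * (real m + 1)"
      by (simp add: power2_eq_square algebra_simps)
    then show ?thesis
      using assms by (simp add: L_def ln_mult)
  qed
  also have "\<dots> = (\<Sum>j\<in>{1..<m}. L (Suc j) - L j)"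
    using assms by (subst sum_Suc_diff') auto
  also have "\<dots> \<le> (\<Sum>j\<in>{1..<m}. 3 * (real j / (real m + (real j)\<^sup>2)))"
    by (rule sum_mono) (use step in auto)
  also have "\<dots> \<le> (\<Sum>j\<in>{0..<m}. 3 * (real j / (real m + (real j)\<^sup>2)))"
    by (rule sum_mono2) (auto intro!: divide_nonneg_nonneg)
  finally have "real m / 6 * ln (real m) \<le>
      real m / 6 * (\<Sum>j\<in>{0..<m}. 3 * (real j / (real m + (real j)\<^sup>2)))"
    by (rule mult_left_mono) simp
  also have "\<dots> = (\<Sum>j\<in>{0..<m}. push_sub m j)"
    unfolding sum_distrib_left by (rule sum.cong) (auto simp: push_sub_def)
  finally show ?thesis .
qed

section \<open>Pull rule: exact increments\<close>

text \<open>
  With \<open>d = pull_diff m\<close> the pull recursion is \<open>(m - j) d j = 2 m + (m + j) d (j - 1)\<close>. Multiplied by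
  the stationary weight \<open>2 m choose (m + j)\<close> of the Ehrenfest chain it turns into the telescoping
  \<open>pull_weight m j = pull_weight m (j - 1) + (2 m choose (m + j))\<close>.
\<close>

definition pull_weight :: "nat \<Rightarrow> nat \<Rightarrow> nat" where
  "pull_weight m j = ((2 * m - 1) choose m) + (\<Sum>i\<in>{1..j}. (2 * m) choose (m + i))"

definition pull_diff :: "nat \<Rightarrow> nat \<Rightarrow> real" where
  "pull_diff m j = real (pull_weight m j) / real ((2 * m - 1) choose (m + j))"

text \<open>The boundary value at balance; the starting term of \<open>pull_weight\<close> equals
  the denominator at \<open>j = 0\<close> for this purpose.\<close>

lemma pull_diff_0: "0 < m \<Longrightarrow> pull_diff m 0 = 1"
  by (simp add: pull_diff_def pull_weight_def)

text \<open>The absorption identities turn \<open>(m - j) / p\<close> and \<open>(m + j) / q\<close>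
  both into \<open>2 * m / P\<close>, so the recursion becomes the telescoping of
  \<open>pull_weight\<close>.\<close>

lemma pull_diff_step:
  assumes "0 < j" "j < m"
  shows "2 * real m + (2 * real m - (real m - real j)) * pull_diff m (j - 1) = (real m - real j) * pull_diff m j"
proof -
  define P p q where "P = real ((2 * m) choose (m + j))" and "p = real ((2 * m - 1) choose (m + j))"
    and "q = real ((2 * m - 1) choose (m + j - 1))"
  define D where "D = real (pull_weight m (j - 1))"
  have pos: "0 < P" "0 < p" "0 < q"
    using assms by (auto simp: P_def p_def q_def)
  have "(2 * m - (m + j)) * ((2 * m) choose (m + j)) = 2 * m * ((2 * m - 1) choose (m + j))"
    by (rule binomial_absorb_comp)
  then have "real ((m - j) * ((2 * m) choose (m + j))) = real (2 * m * ((2 * m - 1) choose (m + j)))"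
    by simp
  then have p: "(real m - real j) * P = 2 * real m * p"
    using assms by (simp only: of_nat_mult of_nat_diff less_imp_le P_def p_def)
  have "(m + j) * ((2 * m) choose (m + j)) = 2 * m * ((2 * m - 1) choose (m + j - 1))"
    using assms by (intro times_binomial_minus1_eq) simp
  then have "real ((m + j) * ((2 * m) choose (m + j))) = real (2 * m * ((2 * m - 1) choose (m + j - 1)))"
    by simp
  then have q: "(real m + real j) * P = 2 * real m * q"
    by (simp add: P_def q_def algebra_simps)
  have W: "real (pull_weight m j) = D + P"
    using assms by (cases j) (simp_all add: pull_weight_def D_def P_def)
  have "(real m + real j) * (D / q) = (real m + real j) * P * D / (q * P)"
    using pos by simp
  then have "(real m + real j) * (D / q) = 2 * real m * D / P"
    unfolding q using pos by simp
  moreover have "(real m - real j) * ((D + P) / p) = (real m - real j) * P * (D + P) / (p * P)"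
    using pos by simp
  then have "(real m - real j) * ((D + P) / p) = 2 * real m * (D + P) / P"
    unfolding p using pos by simp
  moreover have "2 * real m * (D + P) / P = 2 * real m * D / P + 2 * real m"
    using pos by (simp add: field_simps)
  moreover have "pull_diff m (j - 1) = D / q" "pull_diff m j = (D + P) / p"
    using assms W by (simp_all add: pull_diff_def D_def q_def p_def)
  ultimately show ?thesis
    by (simp add: algebra_simps)
qed

text \<open>Once the starting term is raised to the central coefficient, the weight is part of row
  \<open>2 * m\<close> of Pascal's triangle.\<close>

lemma pull_weight_le:
  assumes "j < m"
  shows "pull_weight m j \<le> 2 ^ (2 * m)"
proof -
  have "(2 * m - 1) choose m \<le> (2 * m) choose m"
    by (rule binomial_right_mono) simp
  then have "pull_weight m j \<le> ((2 * m) choose (m + 0)) + (\<Sum>i\<in>{1..j}. (2 * m) choose (m + i))"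
    by (simp add: pull_weight_def)
  also have "\<dots> = (\<Sum>i\<in>{0..j}. (2 * m) choose (m + i))"
    by (simp add: sum.atLeast_Suc_atMost)
  also have "\<dots> = (\<Sum>k\<in>(\<lambda>i. m + i) ` {0..j}. (2 * m) choose k)"
    by (subst sum.reindex) auto
  also have "\<dots> \<le> (\<Sum>k\<le>2 * m. (2 * m) choose k)"
    by (rule sum_mono2) (use assms in auto)
  finally show ?thesis
    by (simp only: choose_row_sum)
qed

lemma choose_symmetric_odd: "j < m \<Longrightarrow> (2 * m - 1) choose (m + j) = (2 * m - 1) choose (m - 1 - j)"
  by (subst binomial_symmetric) (auto simp: mult_2 intro!: arg_cong[of _ _ "binomial _"])

text \<open>The lower half of row \<open>2 * m - 1\<close> sums to \<open>4 ^ (m - 1)\<close>.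
  Reflection moves it to the upper half, which is dominated termwise: index 0 by the starting term,
  the others by row \<open>2 * m\<close>.\<close>

lemma pull_weight_ge:
  assumes "0 < m"
  shows "4 ^ (m - 1) \<le> pull_weight m (m - 1)"
proof -
  have "2 * (m - 1) + 1 = 2 * m - 1"
    using assms by simp
  then have "4 ^ (m - 1) = (\<Sum>k\<le>m - 1. (2 * m - 1) choose k)"
    using binomial_r_part_sum[of "m - 1"] by (simp add: power_mult)
  also have "\<dots> = (\<Sum>k\<in>{..<m}. (2 * m - 1) choose k)"
    using assms by (intro sum.cong) auto
  also have "\<dots> = (\<Sum>j\<in>{..<m}. (2 * m - 1) choose (m - 1 - j))"
    by (subst sum.nat_diff_reindex[symmetric]) simp
  also have "\<dots> = (\<Sum>j\<in>{..<m}. (2 * m - 1) choose (m + j))"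
    by (intro sum.cong refl choose_symmetric_odd[symmetric]) simp
  also have "{..<m} = insert 0 {1..m - 1}"
    using assms by auto
  also have "(\<Sum>j\<in>insert 0 {1..m - 1}. (2 * m - 1) choose (m + j)) \<le> pull_weight m (m - 1)"
    unfolding pull_weight_def by (auto intro!: sum_mono binomial_right_mono)
  finally show ?thesis .
qed

text \<open>All weights are at most \<open>2 ^ (2 * m)\<close>, and the reciprocal binomials sum to
  at most 2: the last is 1 and every other is at most \<open>1 / m\<close>.\<close>

lemma sum_pull_diff_le:
  assumes "0 < m"
  shows "(\<Sum>j\<in>{0..<m}. pull_diff m j) \<le> 2 * 2 ^ (2 * m)"
proof -
  have inv: "1 / real ((2 * m - 1) choose (m + j)) \<le> (if j = m - 1 then 1 else 1 / real m)" if "j < m" for j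
  proof (cases "j = m - 1")
    case True
    then have "(2 * m - 1) choose (m + j) = 1"
      by (subst choose_symmetric_odd[OF that]) simp
    then show ?thesis using True by simp
  next
    case False
    \<comment> \<open>Row \<open>2 * m - 1\<close> increases up to its middle, and
      \<open>m - 1 - j\<close> lies between 1 and the middle.\<close>
    have "(2 * m - 1) choose 1 \<le> (2 * m - 1) choose (m - 1 - j)"
      by (rule binomial_mono) (use False that in auto)
    then have "m \<le> (2 * m - 1) choose (m + j)"
      unfolding choose_symmetric_odd[OF that] using that by simp
    then show ?thesis
      using False assms by (simp add: frac_le)
  qed
  have "(\<Sum>j\<in>{0..<m}. pull_diff m j) \<le> (\<Sum>j\<in>{0..<m}. 2 ^ (2 * m) * (if j = m - 1 then 1 else 1 / real m))"
  proof (rule sum_mono)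
    fix j assume "j \<in> {0..<m}"
    then have j: "j < m" by simp
    have "real (pull_weight m j) \<le> 2 ^ (2 * m)"
      using pull_weight_le[OF j] of_nat_mono by fastforce
    then have "real (pull_weight m j) * (1 / real ((2 * m - 1) choose (m + j))) \<le>
        2 ^ (2 * m) * (if j = m - 1 then 1 else 1 / real m)"
      using inv[OF j] by (intro mult_mono) auto
    then show "pull_diff m j \<le> 2 ^ (2 * m) * (if j = m - 1 then 1 else 1 / real m)"
      by (simp add: pull_diff_def)
  qed
  also have "\<dots> = 2 ^ (2 * m) * (\<Sum>j\<in>{0..<m}. if j = m - 1 then 1 else 1 / real m)"
    by (simp add: sum_distrib_left)
  also have "(\<Sum>j\<in>{0..<m}. if j = m - 1 then 1 else 1 / real m) \<le> (\<Sum>j\<in>{0..<m}. (if j = m - 1 then 1 else 0) + 1 / real m)"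
    by (rule sum_mono) auto
  also have "\<dots> = 2"
    using assms by (simp add: sum.distrib)
  finally show ?thesis
    by simp
qed

lemma pull_diff_nonneg: "0 \<le> pull_diff m j"
  by (simp add: pull_diff_def)

text \<open>The last increment suffices: its denominator is 1, so it equals the full weight.\<close>

lemma sum_pull_diff_ge:
  assumes "0 < m"
  shows "2 ^ (2 * m) / 4 \<le> (\<Sum>j\<in>{0..<m}. pull_diff m j)"
proof -
  have "(2 * m - 1) choose (m + (m - 1)) = 1"
    using choose_symmetric_odd[of "m - 1" m] assms by simp
  then have "pull_diff m (m - 1) = real (pull_weight m (m - 1))"
    by (simp add: pull_diff_def)
  moreover have "real (4 ^ (m - 1)) \<le> real (pull_weight m (m - 1))"
    using pull_weight_ge[OF assms] by (rule of_nat_mono)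
  moreover have "real (4 ^ (m - 1)) = 2 ^ (2 * m) / 4"
    using assms by (cases m) (simp_all add: power_mult)
  moreover have "pull_diff m (m - 1) \<le> (\<Sum>j\<in>{0..<m}. pull_diff m j)"
    using assms by (intro member_le_sum) (auto simp: pull_diff_nonneg)
  ultimately show ?thesis
    by linarith
qed

section \<open>Expected consensus times\<close>

lemma ET_push_bounds:
  assumes "finite V" "card V = 2 * m" "reds V X = m"
  shows "ET_push V (complete_edges V) X < \<infinity>"
    and "enn2real (ET_push V (complete_edges V) X) \<le> (\<Sum>j\<in>{0..<m}. push_super m j)"
    and "(\<Sum>j\<in>{0..<m}. push_sub m j) \<le> enn2real (ET_push V (complete_edges V) X)"
proof -
  interpret imbalance_walk V m "push_step V (complete_edges V)" "\<lambda>j. real (m + j)"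
    by (rule imbalance_walk_push) fact+
  have balanced: "imbalance V m X = 0"
    using assms by (simp add: imbalance_def)
  have nonneg: "0 \<le> push_super m j" "0 \<le> push_sub m j" for j
    by (auto simp: push_super_def push_sub_def)
  have upper: "ET_push V (complete_edges V) X \<le> ennreal (\<Sum>j\<in>{0..<m}. push_super m j)"
    using expected_consensus_time_le[of "push_super m" X] push_super_step
    by (simp add: ET_push_def balanced nonneg push_super_def)
  \<comment> \<open>Finiteness from the upper bound is what the lower bound requires.\<close>
  then show fin: "ET_push V (complete_edges V) X < \<infinity>"
    by (rule order_le_less_trans) simp
  show "enn2real (ET_push V (complete_edges V) X) \<le> (\<Sum>j\<in>{0..<m}. push_super m j)"
    using upper by (intro enn2real_leI sum_nonneg nonneg)
  have "ennreal (\<Sum>j\<in>{0..<m}. push_sub m j) \<le> ET_push V (complete_edges V) X"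
    using expected_consensus_time_ge[of "push_sub m" X] push_sub_step fin
    by (simp add: ET_push_def balanced nonneg push_sub_def)
  then show "(\<Sum>j\<in>{0..<m}. push_sub m j) \<le> enn2real (ET_push V (complete_edges V) X)"
    using fin enn2real_mono by (fastforce simp: sum_nonneg nonneg)
qed

text \<open>\<open>pull_diff\<close> satisfies the recursion and the boundary condition with
  equality, so the same increments serve both bounds and their sum is the exact expectation for
  \<open>0 < m\<close>.\<close>

lemma ET_pull_bounds:
  assumes "finite V" "card V = 2 * m" "reds V X = m"
  shows "ET_pull V (complete_edges V) X < \<infinity>"
    and "0 < m \<Longrightarrow> enn2real (ET_pull V (complete_edges V) X) \<le> (\<Sum>j\<in>{0..<m}. pull_diff m j)"
    and "0 < m \<Longrightarrow> (\<Sum>j\<in>{0..<m}. pull_diff m j) \<le> enn2real (ET_pull V (complete_edges V) X)"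
proof -
  interpret imbalance_walk V m "pull_step V (complete_edges V)" "\<lambda>j. real m - real j"
    by (rule imbalance_walk_pull) fact+
  have balanced: "imbalance V m X = 0"
    using assms by (simp add: imbalance_def)
  have upper: "ET_pull V (complete_edges V) X \<le> ennreal (\<Sum>j\<in>{0..<m}. pull_diff m j)"
    using expected_consensus_time_le[of "pull_diff m" X] pull_diff_step
    by (simp add: ET_pull_def balanced pull_diff_nonneg pull_diff_0)
  then show fin: "ET_pull V (complete_edges V) X < \<infinity>"
    by (rule order_le_less_trans) simp
  show "enn2real (ET_pull V (complete_edges V) X) \<le> (\<Sum>j\<in>{0..<m}. pull_diff m j)"
    using upper by (intro enn2real_leI sum_nonneg pull_diff_nonneg)
  assume "0 < m"
  then have "ennreal (\<Sum>j\<in>{0..<m}. pull_diff m j) \<le> ET_pull V (complete_edges V) X"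
    using expected_consensus_time_ge[of "pull_diff m" X] pull_diff_step fin
    by (simp add: ET_pull_def balanced pull_diff_nonneg pull_diff_0)
  then show "(\<Sum>j\<in>{0..<m}. pull_diff m j) \<le> enn2real (ET_pull V (complete_edges V) X)"
    using fin enn2real_mono by (fastforce simp: sum_nonneg pull_diff_nonneg)
qed

text \<open>From 4 on, \<open>ln n\<close> is at least \<open>2 * ln 2\<close>, so halving the
  argument costs at most half of the logarithm.\<close>

lemma half_log_bounds:
  fixes n :: real
  assumes "4 \<le> n"
  shows "4 * (n / 2) * (1 + ln (n / 2)) \<le> 4 * (n * ln n)"
    and "n * ln n \<le> 24 * (n / 2 / 6 * ln (n / 2))"
proof -
  have half: "ln (n / 2) = ln n - ln 2"
    using assms by (simp add: ln_div)
  have "2 * ln 2 = ln (2 ^ 2 :: real)"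
    by (simp only: ln_realpow)
  also have "\<dots> \<le> ln n"
    using assms by (subst ln_le_cancel_iff) auto
  finally have ln: "2 * ln 2 \<le> ln n" .
  have "1 \<le> 2 * ln (2 :: real)"
    using ln2_ge_two_thirds by linarith
  then have "1 + ln (n / 2) \<le> 2 * ln n"
    using half ln by linarith
  then have "(2 * n) * (1 + ln (n / 2)) \<le> (2 * n) * (2 * ln n)"
    using assms by (intro mult_left_mono) auto
  then show "4 * (n / 2) * (1 + ln (n / 2)) \<le> 4 * (n * ln n)"
    by simp
  have "n * ln n \<le> n * (2 * ln (n / 2))"
    using assms half ln by (intro mult_left_mono) auto
  then show "n * ln n \<le> 24 * (n / 2 / 6 * ln (n / 2))"
    by simp
qed

text \<open>Finiteness is asserted separately because \<open>enn2real\<close> sends infinity to 0.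
  The family \<open>X\<close> is an arbitrary choice of balanced colourings, and the constants in
  the proof (4 and 24 for push, 2 and 4 for pull) do not depend on it.\<close>

theorem theorem1:
  fixes X :: "nat \<Rightarrow> nat config"
  assumes "\<And>n. even n \<Longrightarrow> card {v \<in> {..<n}. X n v = Red} = n div 2"
      and "\<And>n. even n \<Longrightarrow> card {v \<in> {..<n}. X n v = Blue} = n div 2"
  shows "(\<forall>n. even n \<longrightarrow> ET_push {..<n} (complete_edges {..<n}) (X n) < \<infinity>
                      \<and> ET_pull {..<n} (complete_edges {..<n}) (X n) < \<infinity>)
       \<and> (\<lambda>n. enn2real (ET_push {..<n} (complete_edges {..<n}) (X n)))
           \<in> \<Theta>[sequentially \<sqinter> principal {n. even n}](\<lambda>n. real n * ln (real n))
       \<and> (\<lambda>n. enn2real (ET_pull {..<n} (complete_edges {..<n}) (X n)))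
           \<in> \<Theta>[sequentially \<sqinter> principal {n. even n}](\<lambda>n. 2 ^ n)"
proof -
  let ?V = "\<lambda>n. {..<n}" and ?E = "\<lambda>n. complete_edges {..<n}"
  have balanced: "finite (?V n)" "card (?V n) = 2 * (n div 2)" "reds (?V n) (X n) = n div 2"
    if "even n" for n :: nat
    using that assms(1) by (simp_all add: reds_def)
  note push = ET_push_bounds[OF balanced] and pull = ET_pull_bounds[OF balanced]
  have large: "eventually (\<lambda>n. even n \<longrightarrow> P n) sequentially"
    if "\<And>n. 4 \<le> n \<Longrightarrow> even n \<Longrightarrow> P n" for P :: "nat \<Rightarrow> bool"
    using eventually_ge_at_top[of "4::nat"] by eventually_elim (use that in auto)
  have "(\<lambda>n. enn2real (ET_push (?V n) (?E n) (X n)))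
      \<in> \<Theta>[sequentially \<sqinter> principal {n. even n}](\<lambda>n. real n * ln (real n))"
  proof (rule bigthetaI)
    show "(\<lambda>n. enn2real (ET_push (?V n) (?E n) (X n)))
        \<in> O[sequentially \<sqinter> principal {n. even n}](\<lambda>n. real n * ln (real n))"
    proof (rule bigoI[of _ 4], unfold eventually_inf_principal mem_Collect_eq, rule large)
      fix n :: nat assume n: "4 \<le> n" "even n"
      then have "enn2real (ET_push (?V n) (?E n) (X n)) \<le> 4 * (n / 2) * (1 + ln (n / 2))"
        using push(2)[of n] sum_push_super_le[of "n div 2"] by (simp add: real_of_nat_div)
      also have "\<dots> \<le> 4 * (n * ln n)"
        using n by (intro half_log_bounds) simp
      finally show "norm (enn2real (ET_push (?V n) (?E n) (X n))) \<le> 4 * norm (real n * ln (real n))"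
        using n by simp
    qed
    show "(\<lambda>n. enn2real (ET_push (?V n) (?E n) (X n)))
        \<in> \<Omega>[sequentially \<sqinter> principal {n. even n}](\<lambda>n. real n * ln (real n))"
    proof (subst bigomega_iff_bigo, rule bigoI[of _ 24],
        unfold eventually_inf_principal mem_Collect_eq, rule large)
      fix n :: nat assume n: "4 \<le> n" "even n"
      then have "n * ln n \<le> 24 * (n / 2 / 6 * ln (n / 2))"
        by (intro half_log_bounds) simp
      also have "n / 2 / 6 * ln (n / 2) \<le> enn2real (ET_push (?V n) (?E n) (X n))"
        using n push(3)[of n] sum_push_sub_ge[of "n div 2"] by (simp add: real_of_nat_div)
      finally show "norm (real n * ln (real n)) \<le> 24 * norm (enn2real (ET_push (?V n) (?E n) (X n)))"
        using n by simp
    qed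
  qed
  moreover have "(\<lambda>n. enn2real (ET_pull (?V n) (?E n) (X n)))
      \<in> \<Theta>[sequentially \<sqinter> principal {n. even n}](\<lambda>n. 2 ^ n)"
  proof (rule bigthetaI)
    show "(\<lambda>n. enn2real (ET_pull (?V n) (?E n) (X n)))
        \<in> O[sequentially \<sqinter> principal {n. even n}](\<lambda>n. 2 ^ n)"
    proof (rule bigoI[of _ 2], unfold eventually_inf_principal mem_Collect_eq, rule large)
      fix n :: nat assume n: "4 \<le> n" "even n"
      then show "norm (enn2real (ET_pull (?V n) (?E n) (X n))) \<le> 2 * norm (2 ^ n :: real)"
        using pull(2)[of n] sum_pull_diff_le[of "n div 2"] by simp
    qed
    show "(\<lambda>n. enn2real (ET_pull (?V n) (?E n) (X n)))
        \<in> \<Omega>[sequentially \<sqinter> principal {n. even n}](\<lambda>n. 2 ^ n)"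
    proof (subst bigomega_iff_bigo, rule bigoI[of _ 4],
        unfold eventually_inf_principal mem_Collect_eq, rule large)
      fix n :: nat assume n: "4 \<le> n" "even n"
      then show "norm (2 ^ n :: real) \<le> 4 * norm (enn2real (ET_pull (?V n) (?E n) (X n)))"
        using pull(3)[of n] sum_pull_diff_ge[of "n div 2"] by simp
    qed
  qed
  ultimately show ?thesis
    using push(1) pull(1) by blast
qed

end
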